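(* Consider the $N$-state problem with Shannon information costs described in the context, with principal's prior $\mu_p$ satisfying $\mu_p(\omega_1)\ge\dots\ge\mu_p(\omega_N)$, and let $(\mu^*,\{\phi^*_\mu,\sigma^*_\mu\}_{\mu\in\Delta(\Omega)})$ be the equilibrium of the delegation game, with $\mu^*(\omega_i)=\sqrt{\mu_p(\omega_i)}\big/\sum_j\sqrt{\mu_p(\omega_j)}$. Then there exists a communication equilibrium $(\mu^*,\{\tilde\phi^*_\mu,\tilde\sigma^*_\mu\}_{\mu\in\Delta(\Omega)},\sigma^*,\mu_p(\cdot|\cdot))$ that is outcome-equivalent to it, in the sense that the chosen agent $\mu^*$ is the same, $\tilde\phi^*_{\mu^*}=\phi^*_{\mu^*}$, $\tilde\sigma^*_{\mu^*}=\sigma^*_{\mu^*}$, and the principal's choice rule $\sigma^*:\mathcal A\to\mathcal A$ is the identity mapping.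
   Context: $N>2$; states $\Omega=\{\omega_1,\dots,\omega_N\}$, actions $\mathcal A=\{a_1,\dots,a_N\}$, payoffs $u(a_i,\omega_i)=1$, $u(a_i,\omega_j)=0$ for $i\neq j$, common to principal and agents. $\mathcal S$ is a fixed signal space, sufficiently rich (at least $N$ elements). There is one agent for each prior $\mu\in\Delta(\Omega)$. A signal structure is $\phi:\Omega\to\Delta(\mathcal S)$; its cost to agent $\mu$ is $c_E(\phi,\mu)=\lambda\,\big(H(\mu)-\mathbb E[H(\eta(s))]\big)$, $\lambda>0$, where $H(\mu)=-\sum_\omega\mu(\omega)\ln\mu(\omega)$ ($0\ln0=0$), $\eta(s)$ is the posterior from $\mu$ and $\phi$ after $s$, and the expectation is over $s$ under $\mu$ and $\phi$. The principal bears no information cost. Delegation equilibrium: $(\mu^*,\{\phi^*_\mu,\sigma^*_\mu\}_\mu)$ such that (a) for each $\mu$, $(\phi^*_\mu,\sigma^*_\mu)$, with $\sigma_\mu^*:\mathcal S\to\mathcal A$, maximizes $\sum_\omega\mu(\omega)\sum_s\phi(s|\omega)u(\sigma(s),\omega)-c_E(\phi,\mu)$; (b) $\mu^*$ maximizes $\sum_\omega\mu_p(\omega)\sum_s\phi^*_\mu(s|\omega)u(\sigma^*_\mu(s),\omega)$ over $\mu\in\Delta(\Omega)$. It is without loss that distinct used signals lead to distinct actions; the induced rule $\pi^*_\mu(a|\omega)=\sum_{s:\sigma^*_\mu(s)=a}\phi^*_\mu(s|\omega)$ is taken to satisfy, for all $i,j$ (automatically if $\mu(\omega_j)>0$, by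 convention if $\mu(\omega_j)=0$), $\pi^*_\mu(a_i|\omega_j)=\beta(a_i)e^{u(a_i,\omega_j)/\lambda}/\sum_k\beta(a_k)e^{u(a_k,\omega_j)/\lambda}$ where $\beta(a_i)=\sum_j\mu(\omega_j)\pi^*_\mu(a_i|\omega_j)$. Communication game: the principal picks an agent $\mu$; the agent picks $\phi$, observes $s$, and sends a recommendation $\tilde a\in\mathcal A$; the principal observes only $\tilde a$ and chooses $a\in\mathcal A$. Communication equilibrium: $(\mu^*,\{\tilde\phi^*_\mu,\tilde\sigma^*_\mu\}_\mu,\sigma^*,\mu_p(\cdot|\cdot))$ with 1. principal's posteriors $\mu_p(\cdot|\tilde a)\in\Delta(\Omega)$, $\tilde a\in\mathcal A$, obtained from her prior $\mu_p$ and the chosen agent's strategy $(\tilde\phi^*_{\mu^*},\tilde\sigma^*_{\mu^*})$ by Bayes' rule on the equilibrium path (arbitrary for recommendations of probability zero); 2. $\sigma^*:\mathcal A\to\mathcal A$ such that for every $\tilde a$, $\sigma^*(\tilde a)$ maximizes $\sum_\omega\mu_p(\omega|\tilde a)u(a,\omega)$ over $a\in\mathcal A$; 3. for every $\mu$, $\tilde\phi^*_\mu:\Omega\to\Delta(\mathcal S)$ and $\tilde\sigma^*_\mu:\mathcal S\to\mathcal A$ maximize $\sum_\omega\mu(\omega)\sum_s\phi(s|\omega)u(\sigma^*(\tilde\sigma(s)),\omega)-c_E(\phi,\mu)$ over $(\phi,\tilde\sigma)$; 4. $\mu^*$ maximizes $\sum_\omega\mu_p(\omega)\sum_s\tilde\phi^*_\mu(s|\omega)u(\sigma^*(\tilde\sigma^*_\mu(s)),\omega)$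 over $\mu\in\Delta(\Omega)$. *)

theory Defs
  imports "HOL-Probability.Probability" "HOL-Library.Equipollence"
begin

text \<open>
  A finite linearly ordered type \<open>'n\<close> with \<open>N\<close> elements plays the role of the index set
  \<open>{1, ..., N}\<close>. The index \<open>i :: 'n\<close> stands both for the state \<open>\<omega>\<^sub>i\<close> and for the action \<open>a\<^sub>i\<close>.
  Beliefs, i.e. elements of \<open>\<Delta>(\<Omega>)\<close>, are of type \<open>'n pmf\<close>; agents are identified with their
  priors. The signal space is the type \<open>'s\<close>, and a signal structure is a function
  \<open>'n \<Rightarrow> 's pmf\<close>.
\<close>

definition payoff :: "'n \<Rightarrow> 'n \<Rightarrow> real" where
  "payoff a w = (if a = w then 1 else 0)"

text \<open>Since \<open>ln 0 = 0\<close> in HOL, the convention \<open>0 ln 0 = 0\<close> is built in.\<close>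

definition shannon :: "'n::finite pmf \<Rightarrow> real" where
  "shannon \<mu> = - (\<Sum>w\<in>UNIV. pmf \<mu> w * ln (pmf \<mu> w))"

text \<open>
  The distribution of the signal under prior \<open>\<mu>\<close> and signal structure \<open>\<phi>\<close> is \<open>bind_pmf \<mu> \<phi>\<close>.
  The posterior is meaningful only for signals \<open>s\<close> in the support of that distribution.
\<close>

definition posterior :: "'n::finite pmf \<Rightarrow> ('n \<Rightarrow> 's pmf) \<Rightarrow> 's \<Rightarrow> 'n pmf" where
  "posterior \<mu> \<phi> s = embed_pmf (\<lambda>w. pmf \<mu> w * pmf (\<phi> w) s / pmf (bind_pmf \<mu> \<phi>) s)"

definition info_cost :: "real \<Rightarrow> ('n::finite \<Rightarrow> 's pmf) \<Rightarrow> 'n pmf \<Rightarrow> real" where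
  "info_cost lam \<phi> \<mu> =
     lam * (shannon \<mu> - measure_pmf.expectation (bind_pmf \<mu> \<phi>) (\<lambda>s. shannon (posterior \<mu> \<phi> s)))"

definition gross_payoff :: "'n::finite pmf \<Rightarrow> ('n \<Rightarrow> 's pmf) \<Rightarrow> ('s \<Rightarrow> 'n) \<Rightarrow> real" where
  "gross_payoff \<mu> \<phi> \<sigma> =
     (\<Sum>w\<in>UNIV. pmf \<mu> w * measure_pmf.expectation (\<phi> w) (\<lambda>s. payoff (\<sigma> s) w))"

definition net_payoff :: "real \<Rightarrow> 'n::finite pmf \<Rightarrow> ('n \<Rightarrow> 's pmf) \<Rightarrow> ('s \<Rightarrow> 'n) \<Rightarrow> real" where
  "net_payoff lam \<mu> \<phi> \<sigma> = gross_payoff \<mu> \<phi> \<sigma> - info_cost lam \<phi> \<mu>"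

text \<open>
  The induced rule: \<open>pmf (induced_rule \<phi> \<sigma> w) a\<close> is the total \<open>\<phi> w\<close>-probability of the signals
  \<open>s\<close> with \<open>\<sigma> s = a\<close>.
\<close>

definition induced_rule :: "('n \<Rightarrow> 's pmf) \<Rightarrow> ('s \<Rightarrow> 'n) \<Rightarrow> 'n \<Rightarrow> 'n pmf" where
  "induced_rule \<phi> \<sigma> w = map_pmf \<sigma> (\<phi> w)"

definition delegation_equilibrium ::
  "real \<Rightarrow> 'n::finite pmf \<Rightarrow> 'n pmf \<Rightarrow> ('n pmf \<Rightarrow> 'n \<Rightarrow> 's pmf) \<Rightarrow> ('n pmf \<Rightarrow> 's \<Rightarrow> 'n) \<Rightarrow> bool"
where
  "delegation_equilibrium lam \<mu>p \<mu>s \<phi> \<sigma> \<longleftrightarrow>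
     (\<forall>\<mu> (\<phi>' :: 'n \<Rightarrow> 's pmf) \<sigma>'. net_payoff lam \<mu> \<phi>' \<sigma>' \<le> net_payoff lam \<mu> (\<phi> \<mu>) (\<sigma> \<mu>)) \<and>
     (\<forall>\<mu>. gross_payoff \<mu>p (\<phi> \<mu>) (\<sigma> \<mu>) \<le> gross_payoff \<mu>p (\<phi> \<mu>s) (\<sigma> \<mu>s))"

text \<open>
  Conventions on the strategy of agent \<open>\<mu>\<close>: signals sent with positive probability lead to
  distinct actions, and the induced rule has the logit form in every state. The logit form is
  a consequence of optimality in states of positive prior probability and selects
  among optimal strategies in the remaining ones.
\<close>

definition distinct_signals :: "'n pmf \<Rightarrow> ('n \<Rightarrow> 's pmf) \<Rightarrow> ('s \<Rightarrow> 'n) \<Rightarrow> bool" where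
  "distinct_signals \<mu> \<phi> \<sigma> \<longleftrightarrow> inj_on \<sigma> (set_pmf (bind_pmf \<mu> \<phi>))"

definition logit_rule ::
  "real \<Rightarrow> 'n::finite pmf \<Rightarrow> ('n \<Rightarrow> 's pmf) \<Rightarrow> ('s \<Rightarrow> 'n) \<Rightarrow> bool"
where
  "logit_rule lam \<mu> \<phi> \<sigma> \<longleftrightarrow>
     (let \<beta> = (\<lambda>i. \<Sum>j\<in>UNIV. pmf \<mu> j * pmf (induced_rule \<phi> \<sigma> j) i)
      in \<forall>i j. pmf (induced_rule \<phi> \<sigma> j) i =
           \<beta> i * exp (payoff i j / lam) / (\<Sum>k\<in>UNIV. \<beta> k * exp (payoff k j / lam)))"

text \<open>
  Communication: \<open>\<sigma>\<close> maps the agents' signals to recommendations, \<open>\<sigma>s\<close> maps recommendations to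
  the principal's actions, and \<open>\<nu> r\<close> is the principal's posterior after recommendation \<open>r\<close>.
\<close>

definition communication_equilibrium ::
  "real \<Rightarrow> 'n::finite pmf \<Rightarrow> 'n pmf \<Rightarrow> ('n pmf \<Rightarrow> 'n \<Rightarrow> 's pmf) \<Rightarrow> ('n pmf \<Rightarrow> 's \<Rightarrow> 'n)
    \<Rightarrow> ('n \<Rightarrow> 'n) \<Rightarrow> ('n \<Rightarrow> 'n pmf) \<Rightarrow> bool"
where
  "communication_equilibrium lam \<mu>p \<mu>s \<phi> \<sigma> \<sigma>s \<nu> \<longleftrightarrow>
     (let rule = induced_rule (\<phi> \<mu>s) (\<sigma> \<mu>s)
      in \<forall>r \<in> set_pmf (bind_pmf \<mu>p rule). \<nu> r = posterior \<mu>p rule r) \<and>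
     (\<forall>r a. (\<Sum>w\<in>UNIV. pmf (\<nu> r) w * payoff a w) \<le> (\<Sum>w\<in>UNIV. pmf (\<nu> r) w * payoff (\<sigma>s r) w)) \<and>
     (\<forall>\<mu> (\<phi>' :: 'n \<Rightarrow> 's pmf) \<sigma>'. net_payoff lam \<mu> \<phi>' (\<sigma>s \<circ> \<sigma>') \<le> net_payoff lam \<mu> (\<phi> \<mu>) (\<sigma>s \<circ> \<sigma> \<mu>)) \<and>
     (\<forall>\<mu>. gross_payoff \<mu>p (\<phi> \<mu>) (\<sigma>s \<circ> \<sigma> \<mu>) \<le> gross_payoff \<mu>p (\<phi> \<mu>s) (\<sigma>s \<circ> \<sigma> \<mu>s))"

end

theory Submission imports Defs begin

text \<open>
  The agents and the principal keep their delegation strategies, and off the equilibrium path the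
  principal believes the recommendation. It remains to see that following a recommendation that
  is sent with positive probability is optimal for the principal. If \<open>\<beta>\<close> is the action
  distribution of agent \<open>\<mu>s\<close> and \<open>Z j\<close> is the normalising constant of the logit rule in state \<open>j\<close>,
  then the agent earns \<open>lam * (\<Sum>j. \<mu>s j * ln (Z j))\<close>; by Gibbs' inequality the logit rule built from
  any other action weights earns at least the same expression for those weights. Perturbing \<open>\<beta>\<close>
  towards an action \<open>a\<close> therefore shows that \<open>\<mu>s a / Z a \<le> \<mu>s r / Z r\<close> whenever \<open>\<beta> r > 0\<close>.
  Since \<open>Z\<close> takes values in \<open>[1, exp (1 / lam)]\<close> and \<open>\<mu>p\<close> is proportional to \<open>\<mu>s\<^sup>2\<close>, this
  makes \<open>r\<close> the most likely state given the recommendation \<open>r\<close>.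
\<close>

section \<open>Finite distributions and Bayesian posteriors\<close>

lemma pmf_of_finite_weights:
  fixes f :: "'a::finite \<Rightarrow> real"
  assumes "\<And>x. 0 \<le> f x" and "(\<Sum>x\<in>UNIV. f x) = 1"
  shows "pmf (embed_pmf f) = f"
proof
  fix x
  have "(\<integral>\<^sup>+ x. ennreal (f x) \<partial>count_space UNIV) = 1"
    using assms by (simp add: nn_integral_count_space_finite sum_ennreal)
  then show "pmf (embed_pmf f) x = f x"
    using assms(1) by (simp add: pmf_embed_pmf)
qed

lemma pmf_bind_finite:
  fixes \<mu> :: "'n::finite pmf"
  shows "pmf (bind_pmf \<mu> \<phi>) s = (\<Sum>w\<in>UNIV. pmf \<mu> w * pmf (\<phi> w) s)"
  by (simp add: pmf_bind integral_measure_pmf[where A = UNIV])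

lemma pmf_posterior:
  fixes \<mu> :: "'n::finite pmf"
  assumes "s \<in> set_pmf (bind_pmf \<mu> \<phi>)"
  shows "pmf (posterior \<mu> \<phi> s) w = pmf \<mu> w * pmf (\<phi> w) s / pmf (bind_pmf \<mu> \<phi>) s"
proof -
  have "pmf (bind_pmf \<mu> \<phi>) s \<noteq> 0"
    using assms by (simp only: set_pmf_iff not_False_eq_True)
  then have "(\<Sum>w\<in>UNIV. pmf \<mu> w * pmf (\<phi> w) s / pmf (bind_pmf \<mu> \<phi>) s) = 1"
    by (simp add: pmf_bind_finite[of \<mu> \<phi> s] flip: sum_divide_distrib)
  from pmf_of_finite_weights[OF _ this] show ?thesis
    by (simp add: posterior_def)
qed

text \<open>Bayes' rule splits the logarithm of the posterior into that of the prior and that of the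
  likelihood ratio, and the weight of the signal cancels the denominator. With
  \<open>ln 0 = 0\<close> the identity survives when a factor vanishes.\<close>

lemma pmf_posterior_ln:
  fixes \<mu> :: "'n::finite pmf"
  assumes s: "s \<in> set_pmf (bind_pmf \<mu> \<phi>)"
  shows "pmf (bind_pmf \<mu> \<phi>) s * (pmf (posterior \<mu> \<phi> s) w * ln (pmf (posterior \<mu> \<phi> s) w)) =
    pmf \<mu> w * ln (pmf \<mu> w) * pmf (\<phi> w) s +
    pmf \<mu> w * (pmf (\<phi> w) s * ln (pmf (\<phi> w) s / pmf (bind_pmf \<mu> \<phi>) s))"
proof -
  define p where "p = pmf (bind_pmf \<mu> \<phi>) s"
  have p: "p > 0"
    using s unfolding p_def by (simp only: pmf_positive)
  show ?thesis
  proof (cases "pmf \<mu> w = 0 \<or> pmf (\<phi> w) s = 0")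
    case True
    then show ?thesis by (auto simp: pmf_posterior[OF s])
  next
    case False
    then have pos: "pmf \<mu> w > 0" "pmf (\<phi> w) s > 0"
      by (auto simp: pmf_nonneg less_le)
    have "ln (pmf \<mu> w * pmf (\<phi> w) s / p) = ln (pmf \<mu> w) + ln (pmf (\<phi> w) s / p)"
      using pos p by (simp add: ln_mult ln_div)
    then show ?thesis
      using p unfolding pmf_posterior[OF s] p_def[symmetric] by (simp add: algebra_simps)
  qed
qed

section \<open>Information cost as mutual information\<close>

text \<open>This is the symmetry of mutual information: the expected drop in entropy of the state
  equals the expected relative entropy of the signal given the state with respect to its marginal.
  Finite support turns the expectation into a sum.\<close>

lemma info_cost_eq_relative_entropy:
  fixes \<mu> :: "'n::finite pmf"
  assumes fin: "finite (set_pmf (bind_pmf \<mu> \<phi>))"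
  shows "info_cost lam \<phi> \<mu> = lam * (\<Sum>w\<in>UNIV. pmf \<mu> w *
    (\<Sum>s\<in>set_pmf (bind_pmf \<mu> \<phi>). pmf (\<phi> w) s * ln (pmf (\<phi> w) s / pmf (bind_pmf \<mu> \<phi>) s)))"
proof -
  define B where "B = set_pmf (bind_pmf \<mu> \<phi>)"
  have finB: "finite B" using fin by (simp add: B_def)
  let ?D = "\<lambda>w s. pmf (\<phi> w) s * ln (pmf (\<phi> w) s / pmf (bind_pmf \<mu> \<phi>) s)"
  \<comment> \<open>A state of prior probability zero may send signals outside \<open>B\<close> and
    so put mass less than one on it; the factor \<open>pmf \<mu> w\<close> makes this
    harmless.\<close>
  have mass: "pmf \<mu> w * ln (pmf \<mu> w) * (\<Sum>s\<in>B. pmf (\<phi> w) s) = pmf \<mu> w * ln (pmf \<mu> w)" for w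
  proof (cases "pmf \<mu> w = 0")
    case False
    then have "set_pmf (\<phi> w) \<subseteq> B"
      by (auto simp: B_def simp flip: set_pmf_iff)
    then show ?thesis
      using sum_pmf_eq_1[OF finB] by simp
  qed simp
  have "- measure_pmf.expectation (bind_pmf \<mu> \<phi>) (\<lambda>s. shannon (posterior \<mu> \<phi> s))
      = (\<Sum>s\<in>B. \<Sum>w\<in>UNIV. pmf (bind_pmf \<mu> \<phi>) s *
          (pmf (posterior \<mu> \<phi> s) w * ln (pmf (posterior \<mu> \<phi> s) w)))"
    by (subst integral_measure_pmf[OF finB])
      (auto simp: B_def shannon_def sum_negf sum_distrib_left)
  also have "\<dots> = (\<Sum>s\<in>B. \<Sum>w\<in>UNIV. pmf \<mu> w * ln (pmf \<mu> w) * pmf (\<phi> w) s + pmf \<mu> w * ?D w s)"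
    by (intro sum.cong refl pmf_posterior_ln) (simp add: B_def)
  also have "\<dots> = (\<Sum>w\<in>UNIV. pmf \<mu> w * ln (pmf \<mu> w) * (\<Sum>s\<in>B. pmf (\<phi> w) s) +
      pmf \<mu> w * (\<Sum>s\<in>B. ?D w s))"
    by (subst sum.swap) (simp add: sum.distrib sum_distrib_left)
  also have "\<dots> = - shannon \<mu> + (\<Sum>w\<in>UNIV. pmf \<mu> w * (\<Sum>s\<in>B. ?D w s))"
    by (simp add: mass sum.distrib shannon_def)
  finally show ?thesis
    by (simp add: info_cost_def B_def)
qed

lemma bind_induced_rule:
  "bind_pmf \<mu> (induced_rule \<phi> \<sigma>) = map_pmf \<sigma> (bind_pmf \<mu> \<phi>)"
  by (simp add: map_bind_pmf induced_rule_def[abs_def])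

text \<open>Applied with \<open>B\<close> the support of the signal under the prior and
  \<open>M\<close> its law in a single state. Injectivity on all of \<open>B\<close> prevents a
  signal that \<open>M\<close> omits from sharing its image with one that \<open>M\<close>
  sends.\<close>

lemma pmf_map_inj_on_superset:
  assumes "inj_on f B" and "set_pmf M \<subseteq> B" and "x \<in> B"
  shows "pmf (map_pmf f M) (f x) = pmf M x"
proof (cases "x \<in> set_pmf M")
  case True
  then show ?thesis using assms by (intro pmf_map_inj) (auto intro: inj_on_subset)
next
  case False
  then have "f x \<notin> set_pmf (map_pmf f M)"
    using assms by (auto dest: inj_onD)
  then show ?thesis using False by (simp only: set_pmf_iff not_not)
qed

text \<open>Distinct used signals are merely names for actions, so \<open>\<sigma>\<close> relabels
  them without changing gross payoff or mutual information, and the choice rule alone determines the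
  net payoff.\<close>

lemma net_payoff_eq_induced_rule:
  fixes \<mu> :: "'n::finite pmf" and \<phi> :: "'n \<Rightarrow> 's pmf"
  assumes inj: "distinct_signals \<mu> \<phi> \<sigma>"
  defines "\<pi> \<equiv> induced_rule \<phi> \<sigma>"
  shows "net_payoff lam \<mu> \<phi> \<sigma> = (\<Sum>w\<in>UNIV. pmf \<mu> w * (\<Sum>a\<in>UNIV. pmf (\<pi> w) a *
    (payoff a w - lam * ln (pmf (\<pi> w) a / pmf (bind_pmf \<mu> \<pi>) a))))"
proof -
  define B where "B = set_pmf (bind_pmf \<mu> \<phi>)"
  have injB: "inj_on \<sigma> B" using inj by (simp add: B_def distinct_signals_def)
  have finB: "finite B" using finite_imageD[OF _ injB] by simp
  have gross: "measure_pmf.expectation (\<phi> w) (\<lambda>s. payoff (\<sigma> s) w) =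
      (\<Sum>a\<in>UNIV. pmf (\<pi> w) a * payoff a w)" for w
  proof -
    have "measure_pmf.expectation (\<phi> w) (\<lambda>s. payoff (\<sigma> s) w) =
        measure_pmf.expectation (\<pi> w) (\<lambda>a. payoff a w)"
      by (simp add: \<pi>_def induced_rule_def)
    then show ?thesis by (simp add: integral_measure_pmf[where A = UNIV])
  qed
  have cost: "pmf \<mu> w * (\<Sum>s\<in>B. pmf (\<phi> w) s * ln (pmf (\<phi> w) s / pmf (bind_pmf \<mu> \<phi>) s)) =
      pmf \<mu> w * (\<Sum>a\<in>UNIV. pmf (\<pi> w) a * ln (pmf (\<pi> w) a / pmf (bind_pmf \<mu> \<pi>) a))" for w
  proof (cases "pmf \<mu> w = 0")
    case False
    then have sub: "set_pmf (\<phi> w) \<subseteq> B"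
      by (auto simp: B_def simp flip: set_pmf_iff)
    have "pmf (\<pi> w) a = 0" if "a \<notin> \<sigma> ` B" for a
      using that sub by (auto simp: \<pi>_def induced_rule_def pmf_eq_0_set_pmf)
    then have "(\<Sum>a\<in>UNIV. pmf (\<pi> w) a * ln (pmf (\<pi> w) a / pmf (bind_pmf \<mu> \<pi>) a)) =
        (\<Sum>a\<in>\<sigma> ` B. pmf (\<pi> w) a * ln (pmf (\<pi> w) a / pmf (bind_pmf \<mu> \<pi>) a))"
      by (intro sum.mono_neutral_right) auto
    also have "\<dots> = (\<Sum>s\<in>B. pmf (\<phi> w) s * ln (pmf (\<phi> w) s / pmf (bind_pmf \<mu> \<phi>) s))"
      unfolding sum.reindex[OF injB] o_def
    proof (rule sum.cong[OF refl])
      fix s assume s: "s \<in> B"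
      have 1: "pmf (\<pi> w) (\<sigma> s) = pmf (\<phi> w) s"
        using pmf_map_inj_on_superset[OF injB sub s] by (simp add: \<pi>_def induced_rule_def)
      have 2: "pmf (bind_pmf \<mu> \<pi>) (\<sigma> s) = pmf (bind_pmf \<mu> \<phi>) s"
        unfolding \<pi>_def bind_induced_rule
        by (rule pmf_map_inj_on_superset[OF injB _ s]) (simp only: B_def order_refl)
      show "pmf (\<pi> w) (\<sigma> s) * ln (pmf (\<pi> w) (\<sigma> s) / pmf (bind_pmf \<mu> \<pi>) (\<sigma> s)) =
          pmf (\<phi> w) s * ln (pmf (\<phi> w) s / pmf (bind_pmf \<mu> \<phi>) s)"
        by (simp only: 1 2)
    qed
    finally show ?thesis by simp
  qed simp
  have "net_payoff lam \<mu> \<phi> \<sigma> = (\<Sum>w\<in>UNIV. pmf \<mu> w * (\<Sum>a\<in>UNIV. pmf (\<pi> w) a * payoff a w)) -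
     lam * (\<Sum>w\<in>UNIV. pmf \<mu> w *
       (\<Sum>a\<in>UNIV. pmf (\<pi> w) a * ln (pmf (\<pi> w) a / pmf (bind_pmf \<mu> \<pi>) a)))"
    unfolding net_payoff_def gross_payoff_def gross
    using info_cost_eq_relative_entropy[OF finB[unfolded B_def], of lam]
    by (simp only: cost flip: B_def)
  then show ?thesis
    by (simp add: sum_subtractf sum_distrib_left algebra_simps)
qed

section \<open>Payoff of logit rules\<close>

definition logit_norm :: "real \<Rightarrow> ('n::finite \<Rightarrow> real) \<Rightarrow> 'n \<Rightarrow> real" where
  "logit_norm lam b w = (\<Sum>k\<in>UNIV. b k * exp (payoff k w / lam))"

lemma logit_norm_eq:
  assumes "(\<Sum>k\<in>UNIV. b k) = 1"
  shows "logit_norm lam b w = 1 + b w * (exp (1 / lam) - 1)"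
proof -
  have "b k * exp (payoff k w / lam) = b k + (if k = w then b k * (exp (1 / lam) - 1) else 0)" for k
    by (simp add: payoff_def algebra_simps)
  then show ?thesis
    using assms by (simp add: logit_norm_def sum.distrib)
qed

lemma logit_norm_bounds:
  assumes "lam > 0" and "\<And>k. 0 \<le> b k" and "(\<Sum>k\<in>UNIV. b k) = 1"
  shows "1 \<le> logit_norm lam b w" and "logit_norm lam b w \<le> exp (1 / lam)"
proof -
  have "b w \<le> 1"
    using member_le_sum[of w UNIV b] assms by simp
  then have "b w * (exp (1 / lam) - 1) \<le> 1 * (exp (1 / lam) - 1)"
    using assms(1) by (intro mult_right_mono) auto
  moreover have "0 \<le> b w * (exp (1 / lam) - 1)"
    using assms(1,2) by (intro mult_nonneg_nonneg) auto
  ultimately show "1 \<le> logit_norm lam b w" and "logit_norm lam b w \<le> exp (1 / lam)"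
    by (auto simp: logit_norm_eq[OF assms(3)])
qed

text \<open>The weights \<open>b\<close> need not be the action distribution that the rule induces.
  The second term is the relative entropy of that distribution with respect to \<open>b\<close>; it
  measures the mismatch and vanishes when the two agree.\<close>

lemma net_payoff_logit:
  fixes \<mu> :: "'n::finite pmf" and \<phi> :: "'n \<Rightarrow> 's pmf"
  assumes lam: "lam > 0" and inj: "distinct_signals \<mu> \<phi> \<sigma>"
    and b: "\<And>k. 0 \<le> b k" "(\<Sum>k\<in>UNIV. b k) = 1"
  defines "\<pi> \<equiv> induced_rule \<phi> \<sigma>"
  assumes rule: "\<And>w a. pmf (\<pi> w) a = b a * exp (payoff a w / lam) / logit_norm lam b w"
  shows "net_payoff lam \<mu> \<phi> \<sigma> = lam * (\<Sum>w\<in>UNIV. pmf \<mu> w * ln (logit_norm lam b w)) +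
    lam * (\<Sum>a\<in>UNIV. pmf (bind_pmf \<mu> \<pi>) a * ln (pmf (bind_pmf \<mu> \<pi>) a / b a))"
proof -
  define q where "q = pmf (bind_pmf \<mu> \<pi>)"
  have Z: "logit_norm lam b w > 0" for w
    using logit_norm_bounds(1)[where b = b, OF lam b] by (meson less_le_trans zero_less_one)
  have summand: "pmf \<mu> w * (pmf (\<pi> w) a * (payoff a w - lam * ln (pmf (\<pi> w) a / q a))) =
      pmf \<mu> w * (lam * ln (logit_norm lam b w)) * pmf (\<pi> w) a +
      lam * ln (q a / b a) * (pmf \<mu> w * pmf (\<pi> w) a)" for w a
  proof (cases "pmf \<mu> w * pmf (\<pi> w) a = 0")
    case True
    then show ?thesis by auto
  next
    case False
    have "b a > 0" using False b(1)[of a] by (auto simp: rule less_le)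
    moreover have "pmf \<mu> w * pmf (\<pi> w) a \<le> q a"
      unfolding q_def pmf_bind_finite by (rule member_le_sum) auto
    then have "q a > 0" using False
      by (smt (verit) pmf_nonneg mult_nonneg_nonneg)
    ultimately have "ln (pmf (\<pi> w) a / q a) =
        payoff a w / lam - ln (logit_norm lam b w) - ln (q a / b a)"
      using Z[of w] by (simp add: rule ln_mult ln_div)
    then show ?thesis using lam by (simp only:) (simp add: algebra_simps)
  qed
  have "net_payoff lam \<mu> \<phi> \<sigma> = (\<Sum>w\<in>UNIV. \<Sum>a\<in>UNIV.
      pmf \<mu> w * (pmf (\<pi> w) a * (payoff a w - lam * ln (pmf (\<pi> w) a / q a))))"
    unfolding net_payoff_eq_induced_rule[OF inj] q_def \<pi>_def by (simp add: sum_distrib_left)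
  also have "\<dots> = (\<Sum>w\<in>UNIV. pmf \<mu> w * (lam * ln (logit_norm lam b w)) * (\<Sum>a\<in>UNIV. pmf (\<pi> w) a)) +
      (\<Sum>w\<in>UNIV. \<Sum>a\<in>UNIV. lam * ln (q a / b a) * (pmf \<mu> w * pmf (\<pi> w) a))"
    by (simp only: summand sum.distrib sum_distrib_left)
  also have "(\<Sum>w\<in>UNIV. \<Sum>a\<in>UNIV. lam * ln (q a / b a) * (pmf \<mu> w * pmf (\<pi> w) a)) =
      (\<Sum>a\<in>UNIV. lam * ln (q a / b a) * q a)"
    by (subst sum.swap) (simp add: q_def pmf_bind_finite sum_distrib_left)
  finally show ?thesis
    by (simp add: sum_pmf_eq_1 q_def sum_distrib_left algebra_simps)
qed

section \<open>Gibbs' inequality and logit deviations\<close>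

text \<open>Termwise application of \<open>ln t \<le> t - 1\<close> at \<open>t = q x / p x\<close>,
  then summation.\<close>

lemma relative_entropy_nonneg:
  fixes p q :: "'a \<Rightarrow> real"
  assumes "\<And>x. x \<in> A \<Longrightarrow> 0 \<le> p x" and "\<And>x. x \<in> A \<Longrightarrow> 0 \<le> q x"
    and "\<And>x. x \<in> A \<Longrightarrow> q x = 0 \<Longrightarrow> p x = 0" and "sum q A \<le> sum p A"
  shows "0 \<le> (\<Sum>x\<in>A. p x * ln (p x / q x))"
proof -
  have "p x - q x \<le> p x * ln (p x / q x)" if x: "x \<in> A" for x
  proof (cases "p x = 0")
    case True
    then show ?thesis using assms(2)[OF x] by simp
  next
    case False
    then have pos: "p x > 0" "q x > 0"
      using assms(1-3)[OF x] by (auto simp: less_le)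
    then have "ln (q x / p x) \<le> q x / p x - 1"
      by (intro ln_le_minus_one) auto
    then have "1 - q x / p x \<le> ln (p x / q x)"
      using pos by (simp add: ln_div)
    then have "p x * (1 - q x / p x) \<le> p x * ln (p x / q x)"
      using pos by (intro mult_left_mono) auto
    then show ?thesis using pos by (simp add: algebra_simps)
  qed
  then have "(\<Sum>x\<in>A. p x - q x) \<le> (\<Sum>x\<in>A. p x * ln (p x / q x))"
    by (rule sum_mono)
  then show ?thesis using assms(4) by (simp add: sum_subtractf)
qed

lemma logit_deviation:
  fixes \<mu> :: "'n::finite pmf"
  assumes lam: "lam > 0" and rich: "(UNIV :: 'n set) \<lesssim> (UNIV :: 's set)"
    and b: "\<And>k. 0 \<le> b k" "(\<Sum>k\<in>UNIV. b k) = 1"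
  obtains \<phi> :: "'n \<Rightarrow> 's pmf" and \<sigma>
  where "lam * (\<Sum>w\<in>UNIV. pmf \<mu> w * ln (logit_norm lam b w)) \<le> net_payoff lam \<mu> \<phi> \<sigma>"
proof -
  obtain f :: "'n \<Rightarrow> 's" where f: "inj f"
    using rich by (auto simp: lepoll_def)
  have Z: "logit_norm lam b w > 0" for w
    using logit_norm_bounds(1)[where b = b, OF lam b] by (meson less_le_trans zero_less_one)
  define \<pi> where "\<pi> w = embed_pmf (\<lambda>a. b a * exp (payoff a w / lam) / logit_norm lam b w)" for w
  have "pmf (\<pi> w) = (\<lambda>a. b a * exp (payoff a w / lam) / logit_norm lam b w)" for w
    unfolding \<pi>_def
  proof (rule pmf_of_finite_weights)
    show "0 \<le> b a * exp (payoff a w / lam) / logit_norm lam b w" for a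
      using b(1)[of a] Z[of w] by simp
    show "(\<Sum>a\<in>UNIV. b a * exp (payoff a w / lam) / logit_norm lam b w) = 1"
      using Z[of w] by (simp add: logit_norm_def flip: sum_divide_distrib)
  qed
  then have rule: "pmf (\<pi> w) a = b a * exp (payoff a w / lam) / logit_norm lam b w" for w a
    by simp
  define \<phi> where "\<phi> w = map_pmf f (\<pi> w)" for w
  \<comment> \<open>Signals are the actions encoded by the injection \<open>f\<close>;
    \<open>inv f\<close> decodes them and is injective on the range of \<open>f\<close>.\<close>
  have ind: "induced_rule \<phi> (inv f) = \<pi>"
    using f by (auto simp: induced_rule_def \<phi>_def map_pmf_comp)
  have distinct: "distinct_signals \<mu> \<phi> (inv f)"
    using f by (auto simp: distinct_signals_def \<phi>_def intro!: inj_onI)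
  let ?q = "pmf (bind_pmf \<mu> \<pi>)"
  have "0 \<le> (\<Sum>a\<in>UNIV. ?q a * ln (?q a / b a))"
  proof (rule relative_entropy_nonneg)
    show "?q a = 0" if "b a = 0" for a
      using that by (simp add: pmf_bind_finite rule)
    have "sum ?q UNIV = 1" by (rule sum_pmf_eq_1) auto
    then show "sum b UNIV \<le> sum ?q UNIV" using b(2) by simp
  qed (use b in auto)
  then have "lam * (\<Sum>w\<in>UNIV. pmf \<mu> w * ln (logit_norm lam b w)) \<le> net_payoff lam \<mu> \<phi> (inv f)"
    using net_payoff_logit[where b = b, OF lam distinct b, unfolded ind, OF rule] lam by simp
  then show thesis by (rule that)
qed

section \<open>First-order conditions for the agent\<close>

text \<open>The sum of logarithms vanishes at \<open>e = 0\<close>, where its derivative is the sum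
  in the conclusion. A positive derivative would make it positive for small
  \<open>e > 0\<close>.\<close>

lemma sum_nonpos_of_sum_ln_nonpos:
  fixes m x :: "'a \<Rightarrow> real"
  assumes "\<And>e. 0 < e \<Longrightarrow> e < 1 \<Longrightarrow> (\<Sum>j\<in>A. m j * ln (1 + e * x j)) \<le> 0"
  shows "(\<Sum>j\<in>A. m j * x j) \<le> 0"
proof (rule ccontr)
  assume "\<not> ?thesis"
  moreover have "((\<lambda>e. \<Sum>j\<in>A. m j * ln (1 + e * x j)) has_real_derivative (\<Sum>j\<in>A. m j * x j)) (at 0)"
    by (auto intro!: derivative_eq_intros sum.cong)
  ultimately obtain d where d: "d > 0"
    "\<And>h. 0 < h \<Longrightarrow> h < d \<Longrightarrow> 0 < (\<Sum>j\<in>A. m j * ln (1 + h * x j))"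
    using DERIV_pos_inc_right[of "\<lambda>e. \<Sum>j\<in>A. m j * ln (1 + e * x j)" "\<Sum>j\<in>A. m j * x j" 0] by auto
  define h where "h = min d 1 / 2"
  have "0 < h" "h < d" "h < 1" using d(1) by (auto simp: h_def min_def)
  then show False using d(2)[of h] assms[of h] by linarith
qed

text \<open>This is the Kuhn-Tucker inequality for maximizing
  \<open>\<Sum>w. \<mu> w * ln (logit_norm lam b w)\<close> over the simplex of weights
  \<open>b\<close>: at the optimum \<open>\<beta>\<close> the one-sided derivative towards the
  vertex \<open>a\<close> is not positive.\<close>

lemma optimal_logit_first_order:
  fixes \<mu> :: "'n::finite pmf" and \<phi> :: "'n \<Rightarrow> 's pmf"
  assumes lam: "lam > 0" and rich: "(UNIV :: 'n set) \<lesssim> (UNIV :: 's set)"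
    and opt: "\<And>(\<phi>' :: 'n \<Rightarrow> 's pmf) \<sigma>'. net_payoff lam \<mu> \<phi>' \<sigma>' \<le> net_payoff lam \<mu> \<phi> \<sigma>"
    and inj: "distinct_signals \<mu> \<phi> \<sigma>"
  defines "\<beta> \<equiv> pmf (bind_pmf \<mu> (induced_rule \<phi> \<sigma>))"
  assumes rule: "\<And>w a. pmf (induced_rule \<phi> \<sigma> w) a =
    \<beta> a * exp (payoff a w / lam) / logit_norm lam \<beta> w"
  shows "(\<Sum>w\<in>UNIV. pmf \<mu> w * (exp (payoff a w / lam) / logit_norm lam \<beta> w)) \<le> 1"
proof -
  have sum\<beta>: "(\<Sum>k\<in>UNIV. \<beta> k) = 1"
    unfolding \<beta>_def by (rule sum_pmf_eq_1) auto
  have nn\<beta>: "0 \<le> \<beta> k" for k by (simp add: \<beta>_def)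
  have Z: "logit_norm lam \<beta> w > 0" for w
    using logit_norm_bounds(1)[where b = \<beta>, OF lam nn\<beta> sum\<beta>] by (meson less_le_trans zero_less_one)
  \<comment> \<open>Here the weights are the induced action distribution itself, so the relative
    entropy term in \<open>net_payoff_logit\<close> drops out.\<close>
  have "(\<Sum>k\<in>UNIV. \<beta> k * ln (\<beta> k / \<beta> k)) = 0" by (rule sum.neutral) simp
  then have payoff_opt:
    "net_payoff lam \<mu> \<phi> \<sigma> = lam * (\<Sum>w\<in>UNIV. pmf \<mu> w * ln (logit_norm lam \<beta> w))"
    using net_payoff_logit[where b = \<beta>, OF lam inj nn\<beta> sum\<beta> rule]
    by (simp only: mult_zero_right add_0_right flip: \<beta>_def)
  define x where "x w = exp (payoff a w / lam) / logit_norm lam \<beta> w - 1" for w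
  have "(\<Sum>w\<in>UNIV. pmf \<mu> w * x w) \<le> 0"
  proof (rule sum_nonpos_of_sum_ln_nonpos)
    fix e :: real assume e: "0 < e" "e < 1"
    define b where "b k = (1 - e) * \<beta> k + e * of_bool (k = a)" for k
    have b: "0 \<le> b k" for k using e nn\<beta>[of k] by (simp add: b_def)
    have sumb: "(\<Sum>k\<in>UNIV. b k) = 1"
      by (simp add: b_def sum.distrib sum\<beta> of_bool_def flip: sum_distrib_left)
    have Zb: "logit_norm lam b w > 0" for w
      using logit_norm_bounds(1)[where b = b, OF lam b sumb] by (meson less_le_trans zero_less_one)
    have "logit_norm lam b w = (1 - e) * logit_norm lam \<beta> w + e * exp (payoff a w / lam)" for w
    proof -
      have "b k * exp (payoff k w / lam) = (1 - e) * (\<beta> k * exp (payoff k w / lam)) +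
          e * (if k = a then exp (payoff k w / lam) else 0)" for k
        by (simp add: b_def algebra_simps)
      then show ?thesis
        by (simp add: logit_norm_def sum.distrib flip: sum_distrib_left)
    qed
    \<comment> \<open>\<open>logit_norm\<close> is linear in the weights, so \<open>x\<close> is the
      relative change of the normalising constant per unit of \<open>e\<close>.\<close>
    then have ratio: "1 + e * x w = logit_norm lam b w / logit_norm lam \<beta> w" for w
      using Z[of w] by (simp add: x_def field_simps)
    obtain \<phi>' :: "'n \<Rightarrow> 's pmf" and \<sigma>' where
      "lam * (\<Sum>w\<in>UNIV. pmf \<mu> w * ln (logit_norm lam b w)) \<le> net_payoff lam \<mu> \<phi>' \<sigma>'"
      using logit_deviation[where b = b, OF lam rich b sumb] by blast
    from order_trans[OF this opt] have
      "(\<Sum>w\<in>UNIV. pmf \<mu> w * ln (logit_norm lam b w)) \<le> (\<Sum>w\<in>UNIV. pmf \<mu> w * ln (logit_norm lam \<beta> w))"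
      using lam by (simp add: payoff_opt)
    moreover have "ln (1 + e * x w) = ln (logit_norm lam b w) - ln (logit_norm lam \<beta> w)" for w
      unfolding ratio using Z[of w] Zb[of w] by (simp add: ln_div)
    ultimately show "(\<Sum>w\<in>UNIV. pmf \<mu> w * ln (1 + e * x w)) \<le> 0"
      by (simp add: right_diff_distrib sum_subtractf)
  qed
  moreover have "(\<Sum>w\<in>UNIV. pmf \<mu> w) = 1"
    by (rule sum_pmf_eq_1) auto
  ultimately show ?thesis
    by (simp add: x_def right_diff_distrib sum_subtractf)
qed

text \<open>As payoffs are 0 or 1, the first-order sum for action \<open>i\<close> is
  \<open>T + (E - 1) * (pmf \<mu> i / logit_norm lam \<beta> i)\<close>, with \<open>T\<close>
  independent of \<open>i\<close>. It is at most 1 for \<open>a\<close> and exactly 1 for the chosen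
  action \<open>r\<close>.\<close>

lemma optimal_logit_ratio_le:
  fixes \<mu> :: "'n::finite pmf" and \<phi> :: "'n \<Rightarrow> 's pmf"
  assumes lam: "lam > 0" and rich: "(UNIV :: 'n set) \<lesssim> (UNIV :: 's set)"
    and opt: "\<And>(\<phi>' :: 'n \<Rightarrow> 's pmf) \<sigma>'. net_payoff lam \<mu> \<phi>' \<sigma>' \<le> net_payoff lam \<mu> \<phi> \<sigma>"
    and inj: "distinct_signals \<mu> \<phi> \<sigma>"
  defines "\<beta> \<equiv> pmf (bind_pmf \<mu> (induced_rule \<phi> \<sigma>))"
  assumes rule: "\<And>w a. pmf (induced_rule \<phi> \<sigma> w) a =
      \<beta> a * exp (payoff a w / lam) / logit_norm lam \<beta> w"
    and r: "\<beta> r \<noteq> 0"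
  shows "pmf \<mu> a / logit_norm lam \<beta> a \<le> pmf \<mu> r / logit_norm lam \<beta> r"
proof -
  define E where "E = exp (1 / lam)"
  have E: "E > 1" using lam by (simp add: E_def)
  define T where "T = (\<Sum>w\<in>UNIV. pmf \<mu> w / logit_norm lam \<beta> w)"
  have expand: "(\<Sum>w\<in>UNIV. pmf \<mu> w * (exp (payoff i w / lam) / logit_norm lam \<beta> w)) =
      T + (E - 1) * (pmf \<mu> i / logit_norm lam \<beta> i)" for i
  proof -
    have "pmf \<mu> w * (exp (payoff i w / lam) / logit_norm lam \<beta> w) = pmf \<mu> w / logit_norm lam \<beta> w +
        (if w = i then (E - 1) * (pmf \<mu> i / logit_norm lam \<beta> i) else 0)" for w
      by (simp add: payoff_def E_def diff_divide_distrib algebra_simps)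
    then show ?thesis by (simp add: T_def sum.distrib)
  qed
  \<comment> \<open>Averaging the logit formula over states reproduces \<open>\<beta> r\<close>;
    cancelling it gives the equality case.\<close>
  have "\<beta> r = (\<Sum>w\<in>UNIV. pmf \<mu> w * pmf (induced_rule \<phi> \<sigma> w) r)"
    by (simp add: \<beta>_def pmf_bind_finite)
  also have "\<dots> = \<beta> r * (\<Sum>w\<in>UNIV. pmf \<mu> w * (exp (payoff r w / lam) / logit_norm lam \<beta> w))"
    unfolding rule by (simp add: sum_distrib_left algebra_simps)
  finally have "T + (E - 1) * (pmf \<mu> r / logit_norm lam \<beta> r) = 1"
    using r by (simp add: expand del: times_divide_eq_right)
  moreover have "T + (E - 1) * (pmf \<mu> a / logit_norm lam \<beta> a) \<le> 1"
    using optimal_logit_first_order[OF lam rich opt inj, folded \<beta>_def, OF rule, of a]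
    by (simp only: expand)
  ultimately have "(E - 1) * (pmf \<mu> a / logit_norm lam \<beta> a) \<le> (E - 1) * (pmf \<mu> r / logit_norm lam \<beta> r)"
    by linarith
  then show ?thesis using E by (simp only: mult_le_cancel_left_pos diff_gt_0_iff_gt)
qed

section \<open>Obedience of the principal\<close>

lemma sum_pmf_payoff:
  "(\<Sum>w\<in>UNIV. pmf (\<nu> :: 'n::finite pmf) w * payoff a w) = pmf \<nu> a"
proof -
  have "pmf \<nu> w * payoff a w = (if w = a then pmf \<nu> w else 0)" for w
    by (simp add: payoff_def)
  then show ?thesis by simp
qed

theorem proposition4:
  fixes lam :: real
    and \<mu>p \<mu>s :: "'n::{finite,linorder} pmf"
    and \<phi> :: "'n pmf \<Rightarrow> 'n \<Rightarrow> 's pmf"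
    and \<sigma> :: "'n pmf \<Rightarrow> 's \<Rightarrow> 'n"
  assumes "CARD('n) > 2"
    and "(UNIV :: 'n set) \<lesssim> (UNIV :: 's set)"
    and "lam > 0"
    and "antimono (pmf \<mu>p)"
    and "delegation_equilibrium lam \<mu>p \<mu>s \<phi> \<sigma>"
    and "\<And>\<mu>. distinct_signals \<mu> (\<phi> \<mu>) (\<sigma> \<mu>)"
    and "\<And>\<mu>. logit_rule lam \<mu> (\<phi> \<mu>) (\<sigma> \<mu>)"
    and "\<And>i. pmf \<mu>s i = sqrt (pmf \<mu>p i) / (\<Sum>j\<in>UNIV. sqrt (pmf \<mu>p j))"
  shows "\<exists>\<phi>' \<sigma>' \<sigma>s \<nu>. communication_equilibrium lam \<mu>p \<mu>s \<phi>' \<sigma>' \<sigma>s \<nu> \<and>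
           \<phi>' \<mu>s = \<phi> \<mu>s \<and> \<sigma>' \<mu>s = \<sigma> \<mu>s \<and> \<sigma>s = id"
proof -
  define rule where "rule = induced_rule (\<phi> \<mu>s) (\<sigma> \<mu>s)"
  define \<beta> where "\<beta> = pmf (bind_pmf \<mu>s rule)"
  define Z where "Z = logit_norm lam \<beta>"
  define S where "S = (\<Sum>j\<in>UNIV. sqrt (pmf \<mu>p j))"
  have logit: "pmf (rule w) a = \<beta> a * exp (payoff a w / lam) / Z w" for w a
    using assms(7)[of \<mu>s]
    unfolding logit_rule_def Let_def rule_def \<beta>_def Z_def logit_norm_def pmf_bind_finite
    by blast
  have sum\<beta>: "(\<Sum>k\<in>UNIV. \<beta> k) = 1"
    unfolding \<beta>_def by (rule sum_pmf_eq_1) auto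
  have nn\<beta>: "0 \<le> \<beta> k" for k by (simp add: \<beta>_def)
  have Z: "1 \<le> Z w" "Z w \<le> exp (1 / lam)" for w
    unfolding Z_def using logit_norm_bounds[where b = \<beta>, OF assms(3) nn\<beta> sum\<beta>] by blast+
  \<comment> \<open>Otherwise division by zero would give every state probability zero under
    \<open>\<mu>s\<close>.\<close>
  have "S \<noteq> 0"
  proof
    assume "S = 0"
    then have "pmf \<mu>s i = 0" for i by (simp add: assms(8) flip: S_def)
    then show False by (metis pmf_eq_0_set_pmf set_pmf_not_empty equals0I)
  qed
  then have \<mu>p_eq: "pmf \<mu>p i = S\<^sup>2 * (pmf \<mu>s i)\<^sup>2" for i
    by (simp add: assms(8) power_divide flip: S_def)
  have opt: "net_payoff lam \<mu>s \<phi>' \<sigma>' \<le> net_payoff lam \<mu>s (\<phi> \<mu>s) (\<sigma> \<mu>s)"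
    for \<phi>' :: "'n \<Rightarrow> 's pmf" and \<sigma>'
    using assms(5) by (auto simp: delegation_equilibrium_def)
  define \<nu> where
    "\<nu> r = (if r \<in> set_pmf (bind_pmf \<mu>p rule) then posterior \<mu>p rule r else return_pmf r)" for r
  have follow: "pmf (\<nu> r) a \<le> pmf (\<nu> r) r" for r a
  proof (cases "r \<in> set_pmf (bind_pmf \<mu>p rule)")
    case False
    then show ?thesis by (simp add: \<nu>_def pmf_return)
  next
    case r: True
    \<comment> \<open>\<open>r\<close> is on path under the principal's prior, whereas
      \<open>\<beta>\<close> averages over the agent's. The logit form, valid in every state,
      carries positivity from one to the other.\<close>
    then obtain w where "pmf (rule w) r \<noteq> 0"
      by (auto simp: set_pmf_iff[of r])
    then have "\<beta> r \<noteq> 0" by (auto simp: logit)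
    then have c: "pmf \<mu>s a / Z a \<le> pmf \<mu>s r / Z r"
      using optimal_logit_ratio_le[OF assms(3,2) opt assms(6), folded rule_def,
          folded \<beta>_def, folded Z_def, OF logit] by blast
    \<comment> \<open>By Bayes' rule both posteriors share a denominator, so joint probabilities are
      compared. For \<open>a \<noteq> r\<close> this amounts to
      \<open>\<mu>s a ^ 2 / Z a \<le> exp (1 / lam) * \<mu>s r ^ 2 / Z r\<close>: one factor
      \<open>\<mu>s a\<close> uses the upper bound on \<open>Z a\<close>, and the lower bound on
      \<open>Z r\<close> gives \<open>c \<le> \<mu>s r\<close>.\<close>
    have "pmf \<mu>p a * pmf (rule a) r \<le> pmf \<mu>p r * pmf (rule r) r"
    proof (cases "a = r")
      case False
      define c where "c = pmf \<mu>s r / Z r"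
      have pos: "Z a > 0" "Z r > 0" "c \<ge> 0" using Z(1)[of a] Z(1)[of r] by (auto simp: c_def)
      have "pmf \<mu>s a = pmf \<mu>s a / Z a * Z a" using pos by simp
      also have "\<dots> \<le> c * exp (1 / lam)"
        using c Z(2)[of a] pos by (intro mult_mono) (auto simp: c_def)
      finally have "pmf \<mu>s a / Z a * pmf \<mu>s a \<le> c * (c * exp (1 / lam))"
        using c pos by (intro mult_mono) (auto simp: c_def)
      also have "\<dots> \<le> c * (pmf \<mu>s r * exp (1 / lam))"
      proof -
        have "c * 1 \<le> c * Z r" using pos Z(1)[of r] by (intro mult_left_mono) auto
        then have "c \<le> pmf \<mu>s r" using pos by (simp add: c_def)
        then show ?thesis using pos by (intro mult_left_mono mult_right_mono) auto
      qed
      finally have "S\<^sup>2 * \<beta> r * (pmf \<mu>s a / Z a * pmf \<mu>s a) \<le>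
          S\<^sup>2 * \<beta> r * (c * (pmf \<mu>s r * exp (1 / lam)))"
        using nn\<beta>[of r] by (intro mult_left_mono) auto
      then show ?thesis
        using False by (simp add: \<mu>p_eq logit payoff_def c_def power2_eq_square algebra_simps)
    qed simp
    then show ?thesis
      using r by (simp add: \<nu>_def pmf_posterior divide_right_mono del: set_bind_pmf)
  qed
  have "\<forall>r\<in>set_pmf (bind_pmf \<mu>p rule). \<nu> r = posterior \<mu>p rule r"
    by (simp add: \<nu>_def del: set_bind_pmf)
  \<comment> \<open>With the identity as choice rule, the conditions on the agents and on the choice
    of agent are those of the delegation equilibrium.\<close>
  then have "communication_equilibrium lam \<mu>p \<mu>s \<phi> \<sigma> id \<nu>"
    using assms(5) follow
    by (simp add: communication_equilibrium_def delegation_equilibrium_def sum_pmf_payoff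
        flip: rule_def)
  then show ?thesis by blast
qed

end
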